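(* For all integers $n\ge 3$, $\operatorname{th}_-(C_n)=\left\lceil \sqrt{2n}-\frac12\right\rceil$, where $C_n$ is the cycle on $n$ vertices.
   Context: Skew zero forcing on a finite simple undirected graph $G$: each vertex is blue or white; initially exactly the vertices of a set $S\subseteq V(G)$ are blue. In each round, simultaneously, every vertex (blue or white) that has exactly one white neighbor at the start of the round colors that neighbor blue. If all vertices eventually become blue, $S$ is a skew zero forcing set, and the skew propagation time $\operatorname{pt}_-(G;S)$ is the number of rounds needed until all vertices are blue ($0$ if $S=V(G)$); otherwise $\operatorname{pt}_-(G;S)=\infty$. Define $\operatorname{th}_-(G;S)=|S|+\operatorname{pt}_-(G;S)$ and the skew throttling number $\operatorname{th}_-(G)=\min_{S\subseteq V(G)}\operatorname{th}_-(G;S)$. *)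

theory Defs
  imports Complex_Main "HOL-Library.Extended_Nat" "Graph_Theory.Pair_Digraph"
begin

text \<open>
  A finite simple undirected graph is a digraph satisfying \<^locale>\<open>pair_graph\<close>:
  finite, loop-free, without parallel arcs, and with a symmetric arc relation.
\<close>

definition white_neighbors :: "'a pair_pre_digraph \<Rightarrow> 'a set \<Rightarrow> 'a \<Rightarrow> 'a set" where
  "white_neighbors G B v = {w \<in> pverts G. (v, w) \<in> parcs G \<and> w \<notin> B}"

text \<open>
  One round, where \<open>B\<close> is the set of blue vertices at its start. The forcing vertex \<open>v\<close>
  may itself be white.
\<close>

definition skew_round :: "'a pair_pre_digraph \<Rightarrow> 'a set \<Rightarrow> 'a set" where
  "skew_round G B = B \<union> {w. \<exists>v \<in> pverts G. white_neighbors G B v = {w}}"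

definition skew_zero_forcing_set :: "'a pair_pre_digraph \<Rightarrow> 'a set \<Rightarrow> bool" where
  "skew_zero_forcing_set G S \<longleftrightarrow>
     S \<subseteq> pverts G \<and> (\<exists>t. (skew_round G ^^ t) S = pverts G)"

definition skew_pt :: "'a pair_pre_digraph \<Rightarrow> 'a set \<Rightarrow> enat" where
  "skew_pt G S =
     (if skew_zero_forcing_set G S
      then enat (LEAST t. (skew_round G ^^ t) S = pverts G) else \<infinity>)"

definition skew_th_of :: "'a pair_pre_digraph \<Rightarrow> 'a set \<Rightarrow> enat" where
  "skew_th_of G S = enat (card S) + skew_pt G S"

definition skew_th :: "'a pair_pre_digraph \<Rightarrow> enat" where
  "skew_th G = (MIN S \<in> Pow (pverts G). skew_th_of G S)"

text \<open>The cycle on \<open>n\<close> vertices; a simple graph only for \<open>n \<ge> 3\<close>.\<close>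

definition cycle_graph :: "nat \<Rightarrow> nat pair_pre_digraph" where
  "cycle_graph n =
     \<lparr> pverts = {..<n},
       parcs = {(i, j). i < n \<and> j < n \<and> (j = (i + 1) mod n \<or> i = (j + 1) mod n)} \<rparr>"

lemma pair_graph_cycle_graph:
  assumes "n \<ge> 3"
  shows "pair_graph (cycle_graph n)"
proof
  have "parcs (cycle_graph n) \<subseteq> {..<n} \<times> {..<n}"
    by (auto simp: cycle_graph_def)
  then show "finite (parcs (cycle_graph n))"
    by (rule finite_subset) simp
  show "fst e \<noteq> snd e" if "e \<in> parcs (cycle_graph n)" for e
    using that assms by (cases "Suc (fst e) = n") (auto simp: cycle_graph_def)
qed (auto simp: cycle_graph_def symmetric_def sym_def)

end

theory Submission
  imports Defs "HOL-Number_Theory.Cong"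
begin

text \<open>
  A vertex \<open>v\<close> of a cycle has the two neighbours \<open>v - 1\<close> and \<open>v + 1\<close>, and it forces one of them
  exactly when the other one is blue. Hence blue spreads by steps of \<open>\<plusminus>2\<close>, and after \<open>t\<close> rounds the
  blue vertices are the \<open>x + 2j\<close> with \<open>x \<in> S\<close> and \<open>\<bar>j\<bar> \<le> t\<close>. So \<open>S\<close> of size \<open>s\<close> forces in \<open>t\<close>
  rounds only if \<open>n \<le> s(2t + 1)\<close>. If \<open>s + t = k\<close>, the factors of \<open>2s(2t + 1)\<close> add up to \<open>2k + 1\<close>,
  so \<open>2n \<le> k(k + 1)\<close>, which means \<open>k \<ge> \<lceil>sqrt (2n) - 1/2\<rceil>\<close>. Conversely, the steps of \<open>\<plusminus>2\<close> form a
  single cycle for odd \<open>n\<close>, where evenly spread vertices attain the bound. For even \<open>n\<close> they form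
  two cycles, so \<open>s\<close> should be even; what this costs in the product is at most \<open>2\<close>, which parity
  makes up for.
\<close>

section \<open>Vertices as residues modulo \<open>n\<close>\<close>

lemma nat_eq_if_cong_int:
  fixes n v w :: nat
  assumes "[int v = int w] (mod int n)" "v < n" "w < n"
  shows "v = w"
  using assms by (simp add: cong_int_iff cong_less_modulus_unique_nat)

lemma obtain_nat_cong_int:
  fixes n :: nat and z :: int
  assumes "n > 0"
  obtains v where "v < n" "[int v = z] (mod int n)"
proof
  show "nat (z mod int n) < n"
    using assms by (simp add: nat_less_iff)
  show "[int (nat (z mod int n)) = z] (mod int n)"
    using assms by (simp add: cong_def)
qed

text \<open>The signed \<open>d\<close> treats both directions around the cycle at once, and
  integers avoid truncated subtraction.\<close>

lemma cycle_graph_arc_iff: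
  "(v, w) \<in> parcs (cycle_graph n) \<longleftrightarrow>
     v < n \<and> w < n \<and> (\<exists>d::int. \<bar>d\<bar> = 1 \<and> [int w = int v + d] (mod int n))"
proof (cases "v < n \<and> w < n")
  case True
  have "w = (v + 1) mod n \<longleftrightarrow> [w = v + 1] (mod n)" "v = (w + 1) mod n \<longleftrightarrow> [v = w + 1] (mod n)"
    using True by (simp_all add: cong_def)
  moreover have "[w = v + 1] (mod n) \<longleftrightarrow> [int w = int v + 1] (mod int n)"
    by (simp flip: cong_int_iff add: add.commute)
  moreover have "[v = w + 1] (mod n) \<longleftrightarrow> [int w = int v + - 1] (mod int n)"
    by (simp flip: cong_int_iff add: cong_iff_dvd_diff algebra_simps dvd_diff_commute)
  moreover have "(\<exists>d::int. \<bar>d\<bar> = 1 \<and> P d) \<longleftrightarrow> P 1 \<or> P (- 1)" for P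
    by (auto simp: abs_eq_iff')
  ultimately show ?thesis
    using True by (simp add: cycle_graph_def)
qed (auto simp: cycle_graph_def)

section \<open>Blue vertices after any number of rounds\<close>

lemma skew_round_cycle_graph:
  assumes n: "n \<ge> 3" and B: "B \<subseteq> {..<n}"
  shows "skew_round (cycle_graph n) B =
    {w. w < n \<and> (\<exists>x\<in>B. \<exists>d::int. \<bar>d\<bar> \<le> 1 \<and> [int w = int x + 2 * d] (mod int n))}"
    (is "?L = ?R")
proof (intro set_eqI iffI)
  fix w assume "w \<in> ?L"
  then consider "w \<in> B" |
    v where "v < n" "white_neighbors (cycle_graph n) B v = {w}"
    by (auto simp: skew_round_def cycle_graph_def)
  then show "w \<in> ?R"
  proof cases
    case 1
    then have "\<exists>x\<in>B. \<exists>d::int. \<bar>d\<bar> \<le> 1 \<and> [int w = int x + 2 * d] (mod int n)"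
      by (intro bexI[of _ w] exI[of _ 0]) auto
    with 1 B show ?thesis by auto
  next
    case 2
    then have "(v, w) \<in> parcs (cycle_graph n)"
      by (auto simp: white_neighbors_def)
    then obtain d :: int where w: "w < n" and d: "\<bar>d\<bar> = 1" "[int w = int v + d] (mod int n)"
      by (auto simp: cycle_graph_arc_iff)
    \<comment> \<open>\<open>x\<close> is the neighbor of \<open>v\<close> opposite
      \<open>w\<close>; it must be blue, since \<open>w\<close> is the only white one.\<close>
    obtain x where x: "x < n" "[int x = int v - d] (mod int n)"
      using n by (rule_tac obtain_nat_cong_int[of n "int v - d"]) auto
    have wx: "[int w = int x + 2 * d] (mod int n)"
    proof -
      have "[int w - int x = (int v + d) - (int v - d)] (mod int n)"
        using d(2) x(2) by (rule cong_diff)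
      then show ?thesis by (simp add: cong_iff_dvd_diff algebra_simps)
    qed
    \<comment> \<open>Here \<open>n \<ge> 3\<close> enters: the two neighbors of \<open>v\<close>
      could coincide only if \<open>n\<close> divided 2.\<close>
    have "x \<noteq> w"
    proof
      assume "x = w"
      with wx have "int n dvd 2 * d" by (simp add: cong_iff_dvd_diff)
      with d(1) have "int n \<le> 2" using dvd_imp_le_int[of "2 * d" "int n"] by (auto simp: abs_mult)
      with n show False by simp
    qed
    moreover have "(v, x) \<in> parcs (cycle_graph n)"
      using 2 x d(1) by (auto simp: cycle_graph_arc_iff intro!: exI[of _ "- d"])
    ultimately have "x \<in> B"
      using 2 x by (auto simp: white_neighbors_def cycle_graph_def)
    with w wx d(1) show ?thesis by (auto intro!: bexI[of _ x] exI[of _ d])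
  qed
next
  fix w assume "w \<in> ?R"
  then obtain x and d :: int where w: "w < n" and x: "x \<in> B" and d: "\<bar>d\<bar> \<le> 1"
    and wx: "[int w = int x + 2 * d] (mod int n)" by auto
  show "w \<in> ?L"
  proof (cases "w \<in> B")
    case True
    then show ?thesis by (simp add: skew_round_def)
  next
    case False
    have "x < n" using x B by auto
    have "d \<noteq> 0"
    proof
      assume "d = 0"
      then have "w = x" using wx nat_eq_if_cong_int[of w x n] w \<open>x < n\<close> by auto
      with x False show False by simp
    qed
    with d have d1: "\<bar>d\<bar> = 1" by arith
    \<comment> \<open>\<open>v\<close> lies between \<open>x\<close> and \<open>w\<close>. As
      \<open>x\<close> is blue, \<open>v\<close> forces \<open>w\<close> whatever the color of
      \<open>v\<close> itself.\<close>
    obtain v where v: "v < n" "[int v = int x + d] (mod int n)"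
      using n by (rule_tac obtain_nat_cong_int[of n "int x + d"]) auto
    have "white_neighbors (cycle_graph n) B v = {w}"
    proof (intro set_eqI iffI)
      fix u assume u: "u \<in> white_neighbors (cycle_graph n) B v"
      then obtain e :: int where un: "u < n" "u \<notin> B" and e: "\<bar>e\<bar> = 1"
        "[int u = int v + e] (mod int n)"
        by (auto simp: white_neighbors_def cycle_graph_arc_iff)
      have ux: "[int u = int x + d + e] (mod int n)"
        using e(2) cong_add[OF v(2) cong_refl] cong_trans by blast
      have "e \<noteq> - d"
      proof
        assume "e = - d"
        with ux have "u = x" using nat_eq_if_cong_int[of u x n] un \<open>x < n\<close> by auto
        with un x show False by simp
      qed
      with e d1 have "e = d" by arith
      with ux have "[int u = int x + 2 * d] (mod int n)" by (simp add: algebra_simps)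
      with wx have "[int u = int w] (mod int n)" using cong_sym cong_trans by blast
      then show "u \<in> {w}" using nat_eq_if_cong_int un w by simp
    next
      fix u assume "u \<in> {w}"
      have "[int w = int v + d] (mod int n)"
      proof -
        have "[int v + d = int x + d + d] (mod int n)" using v(2) by (rule cong_add) simp
        then have "[int v + d = int x + 2 * d] (mod int n)" by (simp add: algebra_simps)
        with wx show ?thesis using cong_sym cong_trans by blast
      qed
      with d1 v w have "(v, w) \<in> parcs (cycle_graph n)"
        by (auto simp: cycle_graph_arc_iff)
      with False w \<open>u \<in> {w}\<close> show "u \<in> white_neighbors (cycle_graph n) B v"
        by (auto simp: white_neighbors_def cycle_graph_def)
    qed
    with v show ?thesis by (auto simp: skew_round_def cycle_graph_def)
  qed
qed

lemma skew_rounds_cycle_graph: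
  assumes n: "n \<ge> 3" and S: "S \<subseteq> {..<n}"
  shows "(skew_round (cycle_graph n) ^^ t) S =
    {w. w < n \<and> (\<exists>x\<in>S. \<exists>j::int. \<bar>j\<bar> \<le> int t \<and> [int w = int x + 2 * j] (mod int n))}"
proof (induction t)
  case 0
  have "(\<exists>x\<in>S. [int w = int x] (mod int n)) \<longleftrightarrow> w \<in> S" if "w < n" for w
    using that S nat_eq_if_cong_int by (metis cong_refl lessThan_iff subsetD)
  with S show ?case by auto
next
  case (Suc t)
  define B where "B = (skew_round (cycle_graph n) ^^ t) S"
  note B = Suc[folded B_def]
  have "B \<subseteq> {..<n}" by (auto simp: B)
  have "(\<exists>y\<in>B. \<exists>d::int. \<bar>d\<bar> \<le> 1 \<and> [int w = int y + 2 * d] (mod int n)) \<longleftrightarrow>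
        (\<exists>x\<in>S. \<exists>j::int. \<bar>j\<bar> \<le> int (Suc t) \<and> [int w = int x + 2 * j] (mod int n))" for w
  proof
    assume "\<exists>y\<in>B. \<exists>d::int. \<bar>d\<bar> \<le> 1 \<and> [int w = int y + 2 * d] (mod int n)"
    then obtain y x and d j :: int where d: "\<bar>d\<bar> \<le> 1" "[int w = int y + 2 * d] (mod int n)"
      and x: "x \<in> S" and j: "\<bar>j\<bar> \<le> int t" "[int y = int x + 2 * j] (mod int n)"
      by (auto simp: B)
    have "[int w = int x + 2 * j + 2 * d] (mod int n)"
      using d(2) cong_add[OF j(2) cong_refl] cong_trans by blast
    then have "[int w = int x + 2 * (j + d)] (mod int n)" by (simp add: algebra_simps)
    moreover have "\<bar>j + d\<bar> \<le> int (Suc t)" using d(1) j(1) by arith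
    ultimately show "\<exists>x\<in>S. \<exists>j::int. \<bar>j\<bar> \<le> int (Suc t) \<and> [int w = int x + 2 * j] (mod int n)"
      using x by blast
  next
    assume "\<exists>x\<in>S. \<exists>j::int. \<bar>j\<bar> \<le> int (Suc t) \<and> [int w = int x + 2 * j] (mod int n)"
    then obtain x and j :: int where x: "x \<in> S"
      and j: "\<bar>j\<bar> \<le> int (Suc t)" "[int w = int x + 2 * j] (mod int n)" by auto
    \<comment> \<open>The last round takes one unit off \<open>j\<close> towards 0;
      \<open>sgn 0 = 0\<close> covers a vertex that needs no step.\<close>
    have sgn: "\<bar>sgn j\<bar> \<le> 1" "\<bar>j - sgn j\<bar> \<le> int t"
      using j(1) by (auto simp: sgn_if)
    obtain y where y: "y < n" "[int y = int x + 2 * (j - sgn j)] (mod int n)"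
      using n by (rule_tac obtain_nat_cong_int[of n "int x + 2 * (j - sgn j)"]) auto
    have "y \<in> B" using y x sgn(2) unfolding B by blast
    moreover have "[int w = int y + 2 * sgn j] (mod int n)"
    proof -
      have "[int y + 2 * sgn j = int x + 2 * (j - sgn j) + 2 * sgn j] (mod int n)"
        using y(2) by (rule cong_add) simp
      then have "[int y + 2 * sgn j = int x + 2 * j] (mod int n)" by (simp add: algebra_simps)
      with j(2) show ?thesis using cong_sym cong_trans by blast
    qed
    ultimately show "\<exists>y\<in>B. \<exists>d::int. \<bar>d\<bar> \<le> 1 \<and> [int w = int y + 2 * d] (mod int n)"
      using sgn(1) by blast
  qed
  then show ?case
    using skew_round_cycle_graph[OF n \<open>B \<subseteq> {..<n}\<close>] by (simp add: B_def)
qed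

section \<open>Counting bound and construction of forcing sets\<close>

lemma cycle_graph_forced_imp_le:
  assumes n: "n \<ge> 3" and S: "S \<subseteq> {..<n}"
    and forced: "(skew_round (cycle_graph n) ^^ t) S = {..<n}"
  shows "n \<le> card S * (2 * t + 1)"
proof -
  let ?f = "\<lambda>(x, j). nat ((int x + 2 * j) mod int n)"
  \<comment> \<open>Each start vertex reaches at most \<open>2 * t + 1\<close> vertices, one per
    offset \<open>j\<close>; overlaps only strengthen the bound.\<close>
  have "{..<n} \<subseteq> ?f ` (S \<times> {- int t..int t})"
  proof
    fix w assume "w \<in> {..<n}"
    then have "w \<in> (skew_round (cycle_graph n) ^^ t) S" using forced by simp
    then obtain x and j :: int where "w < n" "x \<in> S" "\<bar>j\<bar> \<le> int t"
      and "[int w = int x + 2 * j] (mod int n)"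
      unfolding skew_rounds_cycle_graph[OF n S] by auto
    moreover from this have "w = nat ((int x + 2 * j) mod int n)"
      by (simp add: cong_def flip: of_nat_mod)
    ultimately show "w \<in> ?f ` (S \<times> {- int t..int t})"
      by (intro image_eqI[of _ _ "(x, j)"]) auto
  qed
  moreover have "finite S" using S finite_subset by blast
  ultimately have "n \<le> card (S \<times> {- int t..int t})"
    by (metis surj_card_le card_lessThan finite_SigmaI finite_atLeastAtMost_int)
  also have "\<dots> = card S * (2 * t + 1)"
    by (simp add: card_cartesian_product nat_add_distrib nat_mult_distrib)
  finally show ?thesis .
qed

text \<open>
  The steps of \<open>\<plusminus>2\<close> form \<open>p\<close> cycles. Each is split into \<open>a\<close> runs of at most \<open>2t + 1\<close> consecutive
  members, and the middle member of each run is chosen.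
\<close>

lemma cycle_graph_forced_exists:
  assumes n: "n \<ge> 3"
    and cover: "\<And>w. w < n \<Longrightarrow> \<exists>y e. y < a * (2 * t + 1) \<and> e < p \<and> [w = 2 * y + e] (mod n)"
  shows "\<exists>S. S \<subseteq> {..<n} \<and> card S \<le> a * p \<and> (skew_round (cycle_graph n) ^^ t) S = {..<n}"
proof -
  \<comment> \<open>In cycle \<open>e\<close>, run \<open>i\<close> starts at position
    \<open>i * (2 * t + 1)\<close>, and its middle is \<open>t\<close> further. Middles may coincide
    modulo \<open>n\<close>, so the size of \<open>S\<close> is only bounded above.\<close>
  let ?f = "\<lambda>(i, e). (2 * (i * (2 * t + 1) + t) + e) mod n"
  define S where "S = ?f ` ({..<a} \<times> {..<p})"
  have S: "S \<subseteq> {..<n}" using n by (auto simp: S_def)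
  have "card S \<le> card ({..<a} \<times> {..<p})" unfolding S_def by (rule card_image_le) simp
  then have "card S \<le> a * p" by (simp add: card_cartesian_product)
  moreover have "\<exists>x\<in>S. \<exists>j::int. \<bar>j\<bar> \<le> int t \<and> [int w = int x + 2 * j] (mod int n)"
    if w: "w < n" for w
  proof -
    obtain y e where y: "y < a * (2 * t + 1)" and e: "e < p" and wy: "[w = 2 * y + e] (mod n)"
      using cover[OF w] by blast
    define i where "i = y div (2 * t + 1)"
    define j where "j = int (y mod (2 * t + 1)) - int t"
    have i: "i < a" using y by (simp add: i_def less_mult_imp_div_less)
    have "y mod (2 * t + 1) < 2 * t + 1" by simp
    then have j: "\<bar>j\<bar> \<le> int t" unfolding j_def by arith
    have "y = i * (2 * t + 1) + y mod (2 * t + 1)" unfolding i_def by (metis div_mult_mod_eq)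
    then have "int y = int (i * (2 * t + 1)) + int (y mod (2 * t + 1))"
      by (metis of_nat_add)
    then have eq: "int (2 * y + e) = int (2 * (i * (2 * t + 1) + t) + e) + 2 * j"
      unfolding j_def by (simp add: algebra_simps)
    have "[int w = int (2 * y + e)] (mod int n)"
      using wy by (simp only: cong_int_iff)
    moreover have "[int (?f (i, e)) + 2 * j = int (2 * y + e)] (mod int n)"
      unfolding eq prod.case by (intro cong_add cong_refl) (simp only: cong_int_iff cong_mod_left cong_refl)
    ultimately have "[int w = int (?f (i, e)) + 2 * j] (mod int n)"
      using cong_sym cong_trans by blast
    moreover have "?f (i, e) \<in> S" unfolding S_def using i e by (intro imageI) simp
    ultimately show ?thesis using j by blast
  qed
  then have "(skew_round (cycle_graph n) ^^ t) S = {..<n}"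
    unfolding skew_rounds_cycle_graph[OF n S] by auto
  ultimately show ?thesis using S by blast
qed

section \<open>Splitting \<open>k\<close> between vertices and rounds\<close>

text \<open>With \<open>d = s - t\<close>, the product \<open>(s + t) * (s + t + 1)\<close> exceeds
  \<open>2 * s * (2 * t + 1)\<close> by exactly \<open>d * (d - 1)\<close>, which is nonnegative for
  every integer \<open>d\<close>.\<close>

lemma twice_le_if_le_mult:
  fixes n s t :: nat
  assumes "n \<le> s * (2 * t + 1)"
  shows "2 * n \<le> (s + t) * (s + t + 1)"
proof -
  define d where "d = int s - int t"
  have "d * (d - 1) \<ge> 0"
    by (cases "d \<ge> 1") (auto simp: zero_le_mult_iff)
  then have "2 * (int s * (2 * int t + 1)) \<le> (int s + int t) * (int s + int t + 1)"
    unfolding d_def by (simp add: algebra_simps)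
  then have "int (2 * (s * (2 * t + 1))) \<le> int ((s + t) * (s + t + 1))"
    by (simp only: of_nat_mult of_nat_add of_nat_numeral of_nat_1)
  with assms show ?thesis by linarith
qed

lemma mod4_cases:
  fixes k :: nat
  obtains q where "k = 4 * q" | q where "k = 4 * q + 1" | q where "k = 4 * q + 2"
    | q where "k = 4 * q + 3"
proof -
  have "k = 4 * (k div 4) + k mod 4" by simp
  moreover have "k mod 4 = 0 \<or> k mod 4 = 1 \<or> k mod 4 = 2 \<or> k mod 4 = 3" by arith
  ultimately show ?thesis using that[of "k div 4"] by fastforce
qed

lemma cycle_graph_forced_exists_if_odd:
  assumes n: "n \<ge> 3" "odd n" and k: "2 * n \<le> k * (k + 1)"
  shows "\<exists>S t. S \<subseteq> {..<n} \<and> card S + t \<le> k \<and> (skew_round (cycle_graph n) ^^ t) S = {..<n}"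
proof -
  \<comment> \<open>This makes \<open>s - t\<close> equal to 0 or 1, the two values for which the
    previous estimate loses nothing.\<close>
  define s where "s = (k + 1) div 2"
  define t where "t = k - s"
  have "2 * (s * (2 * t + 1)) = k * (k + 1)"
    by (cases "even k") (auto elim!: evenE oddE simp: s_def t_def algebra_simps)
  with k have le: "n \<le> s * (2 * t + 1)" by linarith
  have "\<exists>y e. y < s * (2 * t + 1) \<and> e < 1 \<and> [w = 2 * y + e] (mod n)" if "w < n" for w
  proof -
    \<comment> \<open>As \<open>n\<close> is odd, one of \<open>w\<close> and \<open>w + n\<close>
      is even, and its half is still below \<open>n\<close>.\<close>
    obtain y where y: "2 * y = (if even w then w else w + n)"
      using n(2) by (metis evenE odd_even_add)
    with that have "y < s * (2 * t + 1)" using le by (auto split: if_splits)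
    moreover have "[w = 2 * y + 0] (mod n)" using y by (simp add: cong_def)
    ultimately show ?thesis by blast
  qed
  from cycle_graph_forced_exists[OF n(1) this]
  obtain S where "S \<subseteq> {..<n}" "card S \<le> s" "(skew_round (cycle_graph n) ^^ t) S = {..<n}"
    by auto
  moreover have "s + t = k" unfolding s_def t_def by simp
  ultimately show ?thesis by (intro exI[of _ S] exI[of _ t]) auto
qed

lemma cycle_graph_forced_exists_if_even:
  assumes n: "n \<ge> 3" "even n" and k: "2 * n \<le> k * (k + 1)"
  shows "\<exists>S t. S \<subseteq> {..<n} \<and> card S + t \<le> k \<and> (skew_round (cycle_graph n) ^^ t) S = {..<n}"
proof -
  obtain m where m: "n = 2 * m" using n(2) by blast
  \<comment> \<open>Now \<open>s = 2 * a\<close>, with \<open>2 * a - t\<close> equal to 0, -1, 2, 1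
    in the four cases. The loss \<open>d * (d - 1)\<close> is 0 or 2, and a loss of 2 is absorbed
    because both \<open>2 * n = 4 * m\<close> and \<open>4 * a * (2 * t + 1)\<close> are multiples
    of 4.\<close>
  have "\<exists>a t. 2 * a + t = k \<and> m \<le> a * (2 * t + 1)"
  proof (cases k rule: mod4_cases)
    case (1 q)
    with k m show ?thesis
      by (intro exI[of _ q] exI[of _ "2 * q"]) (simp add: algebra_simps)
  next
    case (2 q)
    have "4 * m \<le> 4 * (q * (2 * (2 * q + 1) + 1)) + 2"
      using k unfolding m 2 by (simp add: algebra_simps)
    then have "m \<le> q * (2 * (2 * q + 1) + 1)" by presburger
    with 2 show ?thesis
      by (intro exI[of _ q] exI[of _ "2 * q + 1"]) simp
  next
    case (3 q)
    have "4 * m \<le> 4 * ((q + 1) * (2 * (2 * q) + 1)) + 2"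
      using k unfolding m 3 by (simp add: algebra_simps)
    then have "m \<le> (q + 1) * (2 * (2 * q) + 1)" by presburger
    with 3 show ?thesis
      by (intro exI[of _ "q + 1"] exI[of _ "2 * q"]) simp
  next
    case (4 q)
    with k m show ?thesis
      by (intro exI[of _ "q + 1"] exI[of _ "2 * q + 1"]) (simp add: algebra_simps)
  qed
  then obtain a t where t: "2 * a + t = k" and le: "m \<le> a * (2 * t + 1)" by blast
  \<comment> \<open>The two cycles are the parity classes, each with \<open>m\<close>
    members.\<close>
  have "\<exists>y e. y < a * (2 * t + 1) \<and> e < 2 \<and> [w = 2 * y + e] (mod n)" if "w < n" for w
    using that le m by (intro exI[of _ "w div 2"] exI[of _ "w mod 2"]) auto
  from cycle_graph_forced_exists[OF n(1) this]
  obtain S where "S \<subseteq> {..<n}" "card S \<le> a * 2" "(skew_round (cycle_graph n) ^^ t) S = {..<n}"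
    by auto
  with t show ?thesis by (intro exI[of _ S] exI[of _ t]) auto
qed

section \<open>The closed form and the theorem\<close>

text \<open>Squaring \<open>k + 1 / 2\<close> gives \<open>k * (k + 1) + 1 / 4\<close>, and the
  quarter is lost between integers. Having this for every \<open>k\<close> makes the ceiling the
  least solution of the quadratic inequality, which serves both bounds.\<close>

lemma nat_ceiling_sqrt_le_iff:
  "nat \<lceil>sqrt (2 * real n) - 1 / 2\<rceil> \<le> k \<longleftrightarrow> 2 * n \<le> k * (k + 1)"
proof -
  have "nat \<lceil>sqrt (2 * real n) - 1 / 2\<rceil> \<le> k \<longleftrightarrow> sqrt (2 * real n) \<le> real k + 1 / 2"
    by (simp add: nat_le_iff ceiling_le_iff algebra_simps)
  also have "\<dots> \<longleftrightarrow> 2 * real n \<le> (real k + 1 / 2)\<^sup>2"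
    using real_sqrt_le_iff[of "2 * real n" "(real k + 1 / 2)\<^sup>2"] by simp
  also have "\<dots> \<longleftrightarrow> real (2 * n) \<le> real (k * (k + 1)) + 1 / 4"
    by (simp add: power2_eq_square algebra_simps)
  also have "\<dots> \<longleftrightarrow> 2 * n \<le> k * (k + 1)"
  proof
    assume "real (2 * n) \<le> real (k * (k + 1)) + 1 / 4"
    then have "real (2 * n) < real (k * (k + 1) + 1)" by simp
    then show "2 * n \<le> k * (k + 1)" by (simp only: of_nat_less_iff)
  next
    assume "2 * n \<le> k * (k + 1)"
    then have "real (2 * n) \<le> real (k * (k + 1))" by (simp only: of_nat_le_iff)
    then show "real (2 * n) \<le> real (k * (k + 1)) + 1 / 4" by simp
  qed
  finally show ?thesis .
qed

theorem proposition3p1: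
  fixes n :: nat
  assumes "n \<ge> 3"
  shows "skew_th (cycle_graph n) = enat (nat \<lceil>sqrt (2 * real n) - 1 / 2\<rceil>)"
proof -
  define k where "k = nat \<lceil>sqrt (2 * real n) - 1 / 2\<rceil>"
  let ?G = "cycle_graph n"
  have V: "pverts ?G = {..<n}" by (simp add: cycle_graph_def)
  have lower: "enat k \<le> skew_th_of ?G S" if S: "S \<subseteq> {..<n}" for S
  proof (cases "skew_zero_forcing_set ?G S")
    case True
    define t where "t = (LEAST t. (skew_round ?G ^^ t) S = {..<n})"
    have "(skew_round ?G ^^ t) S = {..<n}"
      using True unfolding t_def skew_zero_forcing_set_def V by (metis (mono_tags) LeastI)
    then have "n \<le> card S * (2 * t + 1)"
      using cycle_graph_forced_imp_le[OF assms S] by blast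
    then have "k \<le> card S + t"
      unfolding k_def nat_ceiling_sqrt_le_iff by (rule twice_le_if_le_mult)
    then show ?thesis using True by (simp add: skew_th_of_def skew_pt_def V t_def)
  qed (simp add: skew_th_of_def skew_pt_def)
  have "2 * n \<le> k * (k + 1)"
    using nat_ceiling_sqrt_le_iff[of n k] by (simp add: k_def)
  then obtain S t where S: "S \<subseteq> {..<n}" and t: "card S + t \<le> k"
    and forced: "(skew_round ?G ^^ t) S = {..<n}"
    using cycle_graph_forced_exists_if_odd cycle_graph_forced_exists_if_even assms by meson
  have "skew_zero_forcing_set ?G S"
    using S forced by (auto simp: skew_zero_forcing_set_def V)
  \<comment> \<open>All vertices may be blue before round \<open>t\<close>, so this gives only an
    upper bound; \<open>lower\<close> turns it into equality.\<close>
  moreover have "(LEAST t. (skew_round ?G ^^ t) S = {..<n}) \<le> t"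
    using forced by (rule Least_le)
  ultimately have "skew_th_of ?G S \<le> enat k"
    using t by (simp add: skew_th_of_def skew_pt_def V)
  with lower[OF S] have "skew_th_of ?G S = enat k" by simp
  with S have "enat k \<in> skew_th_of ?G ` Pow {..<n}"
    by (intro image_eqI[of _ _ S]) simp_all
  then show ?thesis
    unfolding skew_th_def V k_def[symmetric] using lower by (intro Min_eqI) auto
qed

end
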